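(* Let $\Gamma$ be a compact Lie group acting linearly on a finite-dimensional real vector space $V$. Let $\sigma:\Gamma\to\mathbf{Z}_2=\{1,-1\}$ be a group epimorphism and let $\Gamma_+=\ker\sigma$. Let $\{u_1,\ldots,u_s\}$ be a Hilbert basis of the ring $\mathcal{P}(\Gamma_+)$. Then the set $$\{R_0(u_i),\ R_1(u_i)R_1(u_j)\ :\ 1\le i,j\le s\}$$ forms a Hilbert basis of the ring $\mathcal{P}(\Gamma)$.
   Context: Polynomial functions here are real-valued polynomial functions $V\to\mathbf{R}$. For a subgroup $K\le\Gamma$, $\mathcal{P}(K)$ is the ring of polynomial functions $f:V\to\mathbf{R}$ with $f(\gamma x)=f(x)$ for all $\gamma\in K$, $x\in V$. A Hilbert basis of $\mathcal{P}(K)$ is a finite set of generators of $\mathcal{P}(K)$ as a ring, i.e. a finite set $\{w_1,\dots,w_n\}\subset\mathcal{P}(K)$ such that every element of $\mathcal{P}(K)$ is of the form $h(w_1,\ldots,w_n)$ for some polynomial $h:\mathbf{R}^n\to\mathbf{R}$ with real coefficients. The relative Reynolds operators $R_0,R_1:\mathcal{P}(\Gamma_+)\to\mathcal{P}(\Gamma_+)$ are given by $$R_0(f)(x)=\tfrac12\bigl(f(x)+f(\delta x)\bigr),\qquad R_1(f)(x)=\tfrac12\bigl(f(x)-f(\delta x)\bigr),$$ where $\delta$ is any fixed element of $\Gamma\setminus\Gamma_+$ (the operators do not depend on the choice of $\delta$). *)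

theory Defs
  imports
    "HOL-Analysis.Analysis"
    "HOL-Algebra.Group_Action"
    "HOL-Algebra.Sym_Groups"
begin

section \<open>Lie groups\<close>

text \<open>For open \<open>S\<close> in a finite-dimensional space this is \<open>k\<close>-fold continuous differentiability:
  all iterated directional derivatives up to order \<open>k\<close> exist and are continuous.\<close>

fun Ck_on :: "nat \<Rightarrow> ('a::real_normed_vector \<Rightarrow> 'b::real_normed_vector) \<Rightarrow> 'a set \<Rightarrow> bool" where
  "Ck_on 0 f S \<longleftrightarrow> continuous_on S f"
| "Ck_on (Suc k) f S \<longleftrightarrow>
     (\<forall>x\<in>S. f differentiable (at x)) \<and> (\<forall>v. Ck_on k (\<lambda>x. frechet_derivative f (at x) v) S)"

text \<open>Smoothness on an arbitrary subset means existence of local smooth extensions. For a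
  relatively open subset of a linear subspace this is the usual notion on that subspace.\<close>

definition smooth_on :: "'a::real_normed_vector set \<Rightarrow> ('a \<Rightarrow> 'b::real_normed_vector) \<Rightarrow> bool" where
  "smooth_on S f \<longleftrightarrow>
     (\<forall>x\<in>S. \<exists>U F. open U \<and> x \<in> U \<and> (\<forall>k. Ck_on k F U) \<and> (\<forall>y\<in>S \<inter> U. F y = f y))"

text \<open>Charts take values in a linear subspace \<open>E\<close> of a Euclidean space instead of the whole type,
  because types of class \<^class>\<open>euclidean_space\<close> have positive dimension, while a Lie group
  may have dimension 0.\<close>

type_synonym ('g, 'e) chart = "'g set \<times> ('g \<Rightarrow> 'e)"

definition chart_on :: "'g topology \<Rightarrow> 'e::euclidean_space set \<Rightarrow> ('g, 'e) chart \<Rightarrow> bool" where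
  "chart_on T E = (\<lambda>(U, \<phi>).
     openin T U \<and> openin (top_of_set E) (\<phi> ` U) \<and>
     homeomorphic_map (subtopology T U) (top_of_set (\<phi> ` U)) \<phi>)"

definition smooth_manifold ::
  "'g topology \<Rightarrow> 'e::euclidean_space set \<Rightarrow> ('g, 'e) chart set \<Rightarrow> bool" where
  "smooth_manifold T E \<A> \<longleftrightarrow>
     subspace E \<and> Hausdorff_space T \<and> second_countable T \<and>
     (\<forall>c\<in>\<A>. chart_on T E c) \<and>
     (\<Union>(U, \<phi>)\<in>\<A>. U) = topspace T \<and>
     (\<forall>(U, \<phi>)\<in>\<A>. \<forall>(V, \<psi>)\<in>\<A>. smooth_on (\<phi> ` (U \<inter> V)) (\<psi> \<circ> inv_into U \<phi>))"

definition prod_atlas :: "('g, 'e) chart set \<Rightarrow> ('h, 'f) chart set \<Rightarrow> ('g \<times> 'h, 'e \<times> 'f) chart set" where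
  "prod_atlas \<A> \<B> = (\<lambda>((U, \<phi>), (V, \<psi>)). (U \<times> V, map_prod \<phi> \<psi>)) ` (\<A> \<times> \<B>)"

definition smooth_map ::
  "'g topology \<Rightarrow> ('g, 'e::euclidean_space) chart set \<Rightarrow>
   'h topology \<Rightarrow> ('h, 'f::euclidean_space) chart set \<Rightarrow> ('g \<Rightarrow> 'h) \<Rightarrow> bool" where
  "smooth_map T \<A> T' \<B> f \<longleftrightarrow>
     continuous_map T T' f \<and>
     (\<forall>(U, \<phi>)\<in>\<A>. \<forall>(V, \<psi>)\<in>\<B>. smooth_on (\<phi> ` (U \<inter> f -` V)) (\<psi> \<circ> f \<circ> inv_into U \<phi>))"

locale lie_group = group G
  for G :: "('g, 'm) monoid_scheme" (structure) +
  fixes T :: "'g topology" and E :: "'e::euclidean_space set" and \<A> :: "('g, 'e) chart set"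
  assumes topspace_eq: "topspace T = carrier G"
    and manifold: "smooth_manifold T E \<A>"
    and smooth_mult: "smooth_map (prod_topology T T) (prod_atlas \<A> \<A>) T \<A> (\<lambda>(x, y). x \<otimes> y)"
    and smooth_inv: "smooth_map T \<A> T \<A> (\<lambda>x. inv x)"

locale compact_lie_group = lie_group +
  assumes compact: "compact_space T"


section \<open>Linear actions\<close>

text \<open>The norm on \<open>'v\<close> only serves to provide the topology; on a finite-dimensional space
  all norms induce the same one.\<close>

locale linear_lie_group_action =
  lie_group G T E \<A> + group_action G "UNIV :: 'v set" \<rho>
  for G :: "('g, 'm) monoid_scheme" (structure)
    and T and E :: "'e::euclidean_space set" and \<A>
    and \<rho> :: "'g \<Rightarrow> 'v::real_normed_vector \<Rightarrow> 'v" +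
  assumes linear_action: "\<And>\<gamma>. \<gamma> \<in> carrier G \<Longrightarrow> linear (\<rho> \<gamma>)"
    and continuous_action:
      "continuous_map (prod_topology T euclidean) euclidean (\<lambda>(\<gamma>, x). \<rho> \<gamma> x)"


section \<open>Invariant polynomials, Hilbert bases and Reynolds operators\<close>

text \<open>On a finite-dimensional space every linear functional is bounded, so
  \<^const>\<open>real_polynomial_function\<close> describes exactly the polynomial functions.\<close>

definition invariant_polynomials ::
  "('g \<Rightarrow> 'v \<Rightarrow> 'v) \<Rightarrow> 'g set \<Rightarrow> ('v::real_normed_vector \<Rightarrow> real) set" where
  "invariant_polynomials \<rho> K =
     {f. real_polynomial_function f \<and> (\<forall>\<gamma>\<in>K. \<forall>x. f (\<rho> \<gamma> x) = f x)}"

text \<open>Real polynomials in the variables \<open>y i\<close>, \<open>i \<in> I\<close>, for a finite index set \<open>I\<close>;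
  the functions \<open>\<alpha>\<close> are the exponent vectors of the monomials.\<close>

definition polynomial_in :: "'i set \<Rightarrow> (('i \<Rightarrow> real) \<Rightarrow> real) \<Rightarrow> bool" where
  "polynomial_in I h \<longleftrightarrow>
     (\<exists>(M :: ('i \<Rightarrow> nat) set) c. finite M \<and> (\<forall>y. h y = (\<Sum>\<alpha>\<in>M. c \<alpha> * (\<Prod>i\<in>I. y i ^ \<alpha> i))))"

text \<open>The polynomial \<open>h\<close> has one variable for each element \<open>w\<close> of the finite set \<open>W\<close>.\<close>

definition hilbert_basis :: "('v \<Rightarrow> real) set \<Rightarrow> ('v \<Rightarrow> real) set \<Rightarrow> bool" where
  "hilbert_basis P W \<longleftrightarrow>
     finite W \<and> W \<subseteq> P \<and> (\<forall>f\<in>P. \<exists>h. polynomial_in W h \<and> (\<forall>x. f x = h (\<lambda>w. w x)))"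

definition reynolds0 :: "('g \<Rightarrow> 'v \<Rightarrow> 'v) \<Rightarrow> 'g \<Rightarrow> ('v \<Rightarrow> real) \<Rightarrow> 'v \<Rightarrow> real" where
  "reynolds0 \<rho> \<delta> f = (\<lambda>x. (f x + f (\<rho> \<delta> x)) / 2)"

definition reynolds1 :: "('g \<Rightarrow> 'v \<Rightarrow> 'v) \<Rightarrow> 'g \<Rightarrow> ('v \<Rightarrow> real) \<Rightarrow> 'v \<Rightarrow> real" where
  "reynolds1 \<rho> \<delta> f = (\<lambda>x. (f x - f (\<rho> \<delta> x)) / 2)"

end

theory Submission
  imports Defs
begin

text \<open>Write \<open>a\<^sub>i = R\<^sub>0(u\<^sub>i)\<close> and \<open>b\<^sub>i = R\<^sub>1(u\<^sub>i)\<close>, and let \<open>A\<close> be the algebra generated by all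
  \<open>a\<^sub>i\<close> and \<open>b\<^sub>i b\<^sub>j\<close>. From \<open>R\<^sub>0(u\<^sub>i g) = a\<^sub>i R\<^sub>0(g) + b\<^sub>i R\<^sub>1(g)\<close> and
  \<open>R\<^sub>1(u\<^sub>i g) = a\<^sub>i R\<^sub>1(g) + b\<^sub>i R\<^sub>0(g)\<close> it follows by induction on the number of factors that
  every polynomial \<open>f\<close> in the \<open>u\<^sub>i\<close> satisfies \<open>R\<^sub>0(f) \<in> A\<close> and \<open>b\<^sub>j R\<^sub>1(f) \<in> A\<close> for all \<open>j\<close>.
  A \<open>\<Gamma>\<close>-invariant \<open>f\<close> is a polynomial in the \<open>u\<^sub>i\<close> with \<open>R\<^sub>0(f) = f\<close>, hence lies in \<open>A\<close>.\<close>

text \<open>The product rule multiplies by a generator only; the induction described above needs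
  exactly this, since \<open>R\<^sub>1(f) R\<^sub>1(g) \<in> A\<close> is not available for general \<open>f\<close> and \<open>g\<close>.\<close>

inductive_set generated_algebra :: "('v \<Rightarrow> real) set \<Rightarrow> ('v \<Rightarrow> real) set"
  for W :: "('v \<Rightarrow> real) set" where
  const: "(\<lambda>x. c) \<in> generated_algebra W"
| add: "\<lbrakk>f \<in> generated_algebra W; g \<in> generated_algebra W\<rbrakk>
    \<Longrightarrow> (\<lambda>x. f x + g x) \<in> generated_algebra W"
| mult_generator: "\<lbrakk>w \<in> W; g \<in> generated_algebra W\<rbrakk>
    \<Longrightarrow> (\<lambda>x. w x * g x) \<in> generated_algebra W"

section \<open>Polynomials in the generators versus the inductively generated algebra\<close>

lemma generated_algebra_sum:
  assumes "\<And>i. i \<in> I \<Longrightarrow> f i \<in> generated_algebra W"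
  shows "(\<lambda>x. \<Sum>i\<in>I. f i x) \<in> generated_algebra W"
  using assms
  by (induction I rule: infinite_finite_induct) (auto intro: generated_algebra.intros)

lemma generated_algebra_mult_power:
  assumes "w \<in> W" "g \<in> generated_algebra W"
  shows "(\<lambda>x. w x ^ n * g x) \<in> generated_algebra W"
proof (induction n)
  case (Suc n)
  then show ?case
    using generated_algebra.mult_generator[OF assms(1)] by (simp add: mult.assoc)
qed (use assms in simp)

text \<open>The product ranges over a subset \<open>J\<close> so that the induction can shrink it
  while the generating set \<open>W\<close> stays fixed. An infinite \<open>J\<close> gives the
  empty product 1, hence a constant.\<close>

lemma generated_algebra_monomial:
  assumes "J \<subseteq> W"
  shows "(\<lambda>x. c * (\<Prod>w\<in>J. w x ^ \<alpha> w)) \<in> generated_algebra W"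
  using assms
proof (induction J rule: infinite_finite_induct)
  case (insert w J)
  then show ?case
    using generated_algebra_mult_power[of w W "\<lambda>x. c * (\<Prod>w\<in>J. w x ^ \<alpha> w)" "\<alpha> w"]
    by (simp add: mult.left_commute)
qed (auto intro: generated_algebra.intros)

lemma generated_algebra_polynomial:
  assumes "polynomial_in W h"
  shows "(\<lambda>x. h (\<lambda>w. w x)) \<in> generated_algebra W"
proof -
  obtain M c where "\<And>y. h y = (\<Sum>\<alpha>\<in>M. c \<alpha> * (\<Prod>w\<in>W. y w ^ \<alpha> w))"
    using assms unfolding polynomial_in_def by blast
  then show ?thesis
    by (simp add: generated_algebra_sum generated_algebra_monomial)
qed

lemma polynomial_in_const: "polynomial_in I (\<lambda>y. c)"
  unfolding polynomial_in_def
  by (intro exI[of _ "{\<lambda>i. 0}"] exI[of _ "\<lambda>\<alpha>. c"]) simp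

lemma polynomial_in_add:
  assumes "polynomial_in I h" "polynomial_in I k"
  shows "polynomial_in I (\<lambda>y. h y + k y)"
proof -
  obtain M c where M: "finite M" and h: "\<And>y. h y = (\<Sum>\<alpha>\<in>M. c \<alpha> * (\<Prod>i\<in>I. y i ^ \<alpha> i))"
    using assms(1) unfolding polynomial_in_def by blast
  obtain N d where N: "finite N" and k: "\<And>y. k y = (\<Sum>\<alpha>\<in>N. d \<alpha> * (\<Prod>i\<in>I. y i ^ \<alpha> i))"
    using assms(2) unfolding polynomial_in_def by blast
  \<comment> \<open>Both coefficient families are extended by zero to the common set of exponents
    \<open>M \<union> N\<close>.\<close>
  let ?e = "\<lambda>\<alpha>. (if \<alpha> \<in> M then c \<alpha> else 0) + (if \<alpha> \<in> N then d \<alpha> else 0)"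
  have "h y + k y = (\<Sum>\<alpha>\<in>M \<union> N. ?e \<alpha> * (\<Prod>i\<in>I. y i ^ \<alpha> i))" for y
  proof -
    have "h y = (\<Sum>\<alpha>\<in>M \<union> N. (if \<alpha> \<in> M then c \<alpha> else 0) * (\<Prod>i\<in>I. y i ^ \<alpha> i))"
      unfolding h using M N by (intro sum.mono_neutral_cong_left) auto
    moreover have "k y = (\<Sum>\<alpha>\<in>M \<union> N. (if \<alpha> \<in> N then d \<alpha> else 0) * (\<Prod>i\<in>I. y i ^ \<alpha> i))"
      unfolding k using M N by (intro sum.mono_neutral_cong_left) auto
    ultimately show ?thesis
      by (simp only: distrib_right sum.distrib)
  qed
  then show ?thesis
    unfolding polynomial_in_def using M N
    by (intro exI[of _ "M \<union> N"] exI[of _ ?e]) simp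
qed

lemma polynomial_in_mult_variable:
  assumes "finite I" "j \<in> I" "polynomial_in I h"
  shows "polynomial_in I (\<lambda>y. y j * h y)"
proof -
  obtain M c where M: "finite M" and h: "\<And>y. h y = (\<Sum>\<alpha>\<in>M. c \<alpha> * (\<Prod>i\<in>I. y i ^ \<alpha> i))"
    using assms(3) unfolding polynomial_in_def by blast
  let ?up = "\<lambda>\<alpha>. \<alpha>(j := Suc (\<alpha> j))" and ?down = "\<lambda>\<alpha>. \<alpha>(j := \<alpha> j - 1)"
  have down_up: "?down (?up \<alpha>) = \<alpha>" for \<alpha> :: "'a \<Rightarrow> nat"
    by simp
  have inj: "inj_on ?up M"
    by (rule inj_on_inverseI[of _ ?down]) (rule down_up)
  have "y j * (\<Prod>i\<in>I. y i ^ \<alpha> i) = (\<Prod>i\<in>I. y i ^ ?up \<alpha> i)" for \<alpha> and y :: "'a \<Rightarrow> real"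
    using assms(1,2) by (simp add: prod.remove[of I j])
  then have "y j * h y = (\<Sum>\<alpha>\<in>?up ` M. c (?down \<alpha>) * (\<Prod>i\<in>I. y i ^ \<alpha> i))" for y
    unfolding sum.reindex[OF inj] h sum_distrib_left o_def down_up
    by (simp add: mult.left_commute del: fun_upd_apply)
  then show ?thesis
    unfolding polynomial_in_def using M
    by (intro exI[of _ "?up ` M"] exI[of _ "\<lambda>\<alpha>. c (?down \<alpha>)"]) simp
qed

lemma generated_algebra_imp_polynomial:
  assumes "finite W" "f \<in> generated_algebra W"
  shows "\<exists>h. polynomial_in W h \<and> (\<forall>x. f x = h (\<lambda>w. w x))"
  using assms(2)
proof induction
  case (const c)
  show ?case
    by (intro exI[of _ "\<lambda>y. c"]) (simp add: polynomial_in_const)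
next
  case (add f g)
  then obtain h k where "polynomial_in W h" "\<forall>x. f x = h (\<lambda>w. w x)"
    "polynomial_in W k" "\<forall>x. g x = k (\<lambda>w. w x)"
    by blast
  then show ?case
    by (intro exI[of _ "\<lambda>y. h y + k y"]) (simp add: polynomial_in_add)
next
  case (mult_generator w g)
  then obtain h where "polynomial_in W h" "\<forall>x. g x = h (\<lambda>w. w x)"
    by blast
  then show ?case
    using mult_generator(1) assms(1)
    by (intro exI[of _ "\<lambda>y. y w * h y"]) (simp add: polynomial_in_mult_variable)
qed

text \<open>Replaces the existence of a polynomial expression by membership in an inductive set, so
  that statements about all polynomials in the generators can be proved by rule induction.\<close>

lemma hilbert_basis_iff_generated_algebra:
  "hilbert_basis P W \<longleftrightarrow> finite W \<and> W \<subseteq> P \<and> P \<subseteq> generated_algebra W"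
proof -
  have "f \<in> generated_algebra W"
    if "polynomial_in W h" "\<forall>x. f x = h (\<lambda>w. w x)" for f :: "'a \<Rightarrow> real" and h
  proof -
    have "f = (\<lambda>x. h (\<lambda>w. w x))"
      using that(2) by blast
    then show ?thesis
      using generated_algebra_polynomial[OF that(1)] by simp
  qed
  then show ?thesis
    unfolding hilbert_basis_def using generated_algebra_imp_polynomial by blast
qed

section \<open>Reynolds operators on the generated algebra\<close>

text \<open>Any \<open>f\<close> is \<open>R0 f + R1 f\<close>, and its composition with
  \<open>\<rho> \<delta>\<close> is \<open>R0 f - R1 f\<close>. Multiplying out for \<open>u\<close>
  and \<open>g\<close>, the mixed terms cancel in the half sum and the pure terms in the half
  difference.\<close>

lemma reynolds0_mult:
  "reynolds0 \<rho> \<delta> (\<lambda>x. u x * g x) =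
    (\<lambda>x. reynolds0 \<rho> \<delta> u x * reynolds0 \<rho> \<delta> g x + reynolds1 \<rho> \<delta> u x * reynolds1 \<rho> \<delta> g x)"
  by (simp add: reynolds0_def reynolds1_def fun_eq_iff field_simps)

lemma reynolds1_mult:
  "reynolds1 \<rho> \<delta> (\<lambda>x. u x * g x) =
    (\<lambda>x. reynolds0 \<rho> \<delta> u x * reynolds1 \<rho> \<delta> g x + reynolds1 \<rho> \<delta> u x * reynolds0 \<rho> \<delta> g x)"
  by (simp add: reynolds0_def reynolds1_def fun_eq_iff field_simps)

lemma reynolds_add:
  "reynolds0 \<rho> \<delta> (\<lambda>x. f x + g x) = (\<lambda>x. reynolds0 \<rho> \<delta> f x + reynolds0 \<rho> \<delta> g x)"
  "reynolds1 \<rho> \<delta> (\<lambda>x. f x + g x) = (\<lambda>x. reynolds1 \<rho> \<delta> f x + reynolds1 \<rho> \<delta> g x)"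
  by (simp_all add: reynolds0_def reynolds1_def fun_eq_iff field_simps)

lemma reynolds_const:
  "reynolds0 \<rho> \<delta> (\<lambda>x. c) = (\<lambda>x. c)"
  "reynolds1 \<rho> \<delta> (\<lambda>x. c) = (\<lambda>x. 0)"
  by (simp_all add: reynolds0_def reynolds1_def)

text \<open>The second conjunct strengthens the induction: expanding \<open>R0 (u g)\<close>
  produces \<open>R1 u * R1 g\<close>, which the first conjunct alone does not control.\<close>

lemma reynolds_generated_algebra:
  assumes f: "f \<in> generated_algebra U"
    and W0: "\<And>u. u \<in> U \<Longrightarrow> reynolds0 \<rho> \<delta> u \<in> W"
    and W1: "\<And>u v. \<lbrakk>u \<in> U; v \<in> U\<rbrakk> \<Longrightarrow> (\<lambda>x. reynolds1 \<rho> \<delta> u x * reynolds1 \<rho> \<delta> v x) \<in> W"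
  shows "reynolds0 \<rho> \<delta> f \<in> generated_algebra W \<and>
    (\<forall>v\<in>U. (\<lambda>x. reynolds1 \<rho> \<delta> v x * reynolds1 \<rho> \<delta> f x) \<in> generated_algebra W)"
  using f
proof induction
  case (const c)
  show ?case
    by (simp add: reynolds_const generated_algebra.const)
next
  case (add f g)
  then show ?case
    by (simp add: reynolds_add distrib_left generated_algebra.add)
next
  case (mult_generator u g)
  have "reynolds0 \<rho> \<delta> (\<lambda>x. u x * g x) \<in> generated_algebra W"
    unfolding reynolds0_mult
  proof (rule generated_algebra.add)
    show "(\<lambda>x. reynolds0 \<rho> \<delta> u x * reynolds0 \<rho> \<delta> g x) \<in> generated_algebra W"
      using mult_generator by (auto intro: generated_algebra.mult_generator[OF W0])
    show "(\<lambda>x. reynolds1 \<rho> \<delta> u x * reynolds1 \<rho> \<delta> g x) \<in> generated_algebra W"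
      using mult_generator by blast
  qed
  moreover have "(\<lambda>x. reynolds1 \<rho> \<delta> v x * reynolds1 \<rho> \<delta> (\<lambda>x. u x * g x) x) \<in> generated_algebra W"
    if "v \<in> U" for v
  proof -
    \<comment> \<open>The expansion of \<open>R1 v * R1 (u g)\<close>, bracketed so that each
      summand is an element of \<open>W\<close> times a function covered by the induction
      hypothesis.\<close>
    have "(\<lambda>x. reynolds0 \<rho> \<delta> u x * (reynolds1 \<rho> \<delta> v x * reynolds1 \<rho> \<delta> g x)
        + (reynolds1 \<rho> \<delta> v x * reynolds1 \<rho> \<delta> u x) * reynolds0 \<rho> \<delta> g x) \<in> generated_algebra W"
    proof (rule generated_algebra.add)
      show "(\<lambda>x. reynolds0 \<rho> \<delta> u x * (reynolds1 \<rho> \<delta> v x * reynolds1 \<rho> \<delta> g x)) \<in> generated_algebra W"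
        using mult_generator that by (auto intro: generated_algebra.mult_generator[OF W0])
      show "(\<lambda>x. (reynolds1 \<rho> \<delta> v x * reynolds1 \<rho> \<delta> u x) * reynolds0 \<rho> \<delta> g x) \<in> generated_algebra W"
        using mult_generator by (auto intro: generated_algebra.mult_generator[OF W1[OF that]])
    qed
    then show ?thesis
      by (simp add: reynolds1_mult algebra_simps)
  qed
  ultimately show ?case
    by blast
qed

section \<open>The action preserves polynomial functions\<close>

lemma linear_continuous_imp_bounded_linear:
  fixes f :: "'a::real_normed_vector \<Rightarrow> 'b::real_normed_vector"
  assumes "linear f" "isCont f 0"
  shows "bounded_linear f"
proof -
  interpret linear f by fact
  obtain d where d: "d > 0" "\<And>x. norm x < d \<Longrightarrow> norm (f x) < 1"
    using assms(2) unfolding continuous_at_eps_delta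
    by (metis dist_0_norm dist_commute zero zero_less_one)
  have "norm (f x) \<le> norm x * (2 / d)" for x
  proof (cases "x = 0")
    case False
    \<comment> \<open>This factor gives \<open>t *\<^sub>R x\<close> the norm \<open>d / 2\<close>,
      strictly inside the ball on which \<open>f\<close> is bounded by 1.\<close>
    define t where "t = d / (2 * norm x)"
    have t: "t > 0"
      using False d(1) by (simp add: t_def)
    have "norm (t *\<^sub>R x) < d"
      using False d(1) by (simp add: t_def)
    then have "t * norm (f x) < 1"
      using d(2)[of "t *\<^sub>R x"] t by (simp add: scale)
    then have "norm (f x) < 1 / t"
      using t by (simp add: field_simps)
    also have "1 / t = norm x * (2 / d)"
      by (simp add: t_def)
    finally show ?thesis
      by simp
  qed (simp add: zero)
  then show ?thesis
    by (intro bounded_linear_intro[of f "2 / d"]) (simp_all add: add scale)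
qed

text \<open>Polynomial functions are built from bounded linear functionals, and these are stable
  under precomposition with \<open>L\<close> because \<open>L\<close> is bounded.\<close>

lemma real_polynomial_function_compose_bounded_linear:
  assumes "real_polynomial_function p" "bounded_linear L"
  shows "real_polynomial_function (\<lambda>x. p (L x))"
  using assms(1)
proof induction
  case (linear f)
  then show ?case
    using bounded_linear_compose[OF _ assms(2)] by blast
qed auto

lemma (in linear_lie_group_action) bounded_linear_action:
  assumes "\<gamma> \<in> carrier G"
  shows "bounded_linear (\<rho> \<gamma>)"
proof -
  \<comment> \<open>Restricting the jointly continuous action to the slice over \<gamma> gives
    continuity of \<open>\<rho> \<gamma>\<close>.\<close>
  have "continuous_map euclidean (prod_topology T euclidean) (\<lambda>x::'v. (\<gamma>, x))"
    using assms topspace_eq by (simp add: continuous_map_pairwise o_def)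
  from continuous_map_compose[OF this continuous_action]
  have "continuous_on UNIV (\<rho> \<gamma>)"
    by (simp add: o_def)
  then have "isCont (\<rho> \<gamma>) 0"
    by (simp add: continuous_on_eq_continuous_at)
  with linear_action[OF assms] show ?thesis
    by (rule linear_continuous_imp_bounded_linear)
qed

section \<open>Generators of the ring of \<Gamma>-invariants\<close>

theorem theorem3p2:
  fixes \<Gamma> :: "('g, 'm) monoid_scheme"
    and T :: "'g topology" and E :: "'e::euclidean_space set" and \<A> :: "('g, 'e) chart set"
    and \<rho> :: "'g \<Rightarrow> 'v::real_normed_vector \<Rightarrow> 'v"
    and \<sigma> :: "'g \<Rightarrow> int" and \<Gamma>\<^sub>p :: "'g set" and \<delta> :: 'g
    and s :: nat and u :: "nat \<Rightarrow> 'v \<Rightarrow> real"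
  assumes "compact_lie_group \<Gamma> T E \<A>"
    and "\<exists>B :: 'v set. finite B \<and> span B = UNIV"
    and "linear_lie_group_action \<Gamma> T E \<A> \<rho>"
    and "\<sigma> \<in> epi \<Gamma> sign_img"
    and "\<Gamma>\<^sub>p = kernel \<Gamma> sign_img \<sigma>"
    and "\<delta> \<in> carrier \<Gamma> - \<Gamma>\<^sub>p"
    and "hilbert_basis (invariant_polynomials \<rho> \<Gamma>\<^sub>p) (u ` {1..s})"
  shows "hilbert_basis (invariant_polynomials \<rho> (carrier \<Gamma>))
    ({reynolds0 \<rho> \<delta> (u i) | i. i \<in> {1..s}} \<union>
     {(\<lambda>x. reynolds1 \<rho> \<delta> (u i) x * reynolds1 \<rho> \<delta> (u j) x) | i j. i \<in> {1..s} \<and> j \<in> {1..s}})"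
proof -
  interpret linear_lie_group_action \<Gamma> T E \<A> \<rho> by fact
  let ?U = "u ` {1..s}"
  let ?W = "{reynolds0 \<rho> \<delta> (u i) | i. i \<in> {1..s}} \<union>
     {(\<lambda>x. reynolds1 \<rho> \<delta> (u i) x * reynolds1 \<rho> \<delta> (u j) x) | i j. i \<in> {1..s} \<and> j \<in> {1..s}}"
  have \<sigma>_mult: "\<sigma> (a \<otimes>\<^bsub>\<Gamma>\<^esub> b) = \<sigma> a * \<sigma> b" if "a \<in> carrier \<Gamma>" "b \<in> carrier \<Gamma>" for a b
    using assms(4) that by (auto simp: epi_def hom_def sign_img_def)
  have \<sigma>_values: "\<sigma> a = 1 \<or> \<sigma> a = -1" if "a \<in> carrier \<Gamma>" for a
    using assms(4) that by (auto simp: epi_def hom_def sign_img_def)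
  have \<Gamma>\<^sub>p_iff: "a \<in> \<Gamma>\<^sub>p \<longleftrightarrow> a \<in> carrier \<Gamma> \<and> \<sigma> a = 1" for a
    using assms(5) by (simp add: kernel_def sign_img_def)
  have \<delta>: "\<delta> \<in> carrier \<Gamma>" "\<sigma> \<delta> = -1"
    using assms(6) \<Gamma>\<^sub>p_iff \<sigma>_values by auto
  have \<rho>_mult: "\<rho> (a \<otimes>\<^bsub>\<Gamma>\<^esub> b) x = \<rho> a (\<rho> b x)" if "a \<in> carrier \<Gamma>" "b \<in> carrier \<Gamma>" for a b x
    using composition_rule[of x a b] that by simp
  have basis: "finite ?U" "?U \<subseteq> invariant_polynomials \<rho> \<Gamma>\<^sub>p"
    "invariant_polynomials \<rho> \<Gamma>\<^sub>p \<subseteq> generated_algebra ?U"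
    using assms(7) by (simp_all add: hilbert_basis_iff_generated_algebra)

  \<comment> \<open>The kernel has index two, so the elements outside it form the single coset
    \<open>\<Gamma>\<^sub>p \<delta>\<close>; a \<open>\<Gamma>\<^sub>p\<close>-invariant function
    sees only the sign of \<gamma>.\<close>
  have coset: "f (\<rho> \<gamma> x) = (if \<sigma> \<gamma> = 1 then f x else f (\<rho> \<delta> x))"
    if f: "f \<in> invariant_polynomials \<rho> \<Gamma>\<^sub>p" and \<gamma>: "\<gamma> \<in> carrier \<Gamma>" for f \<gamma> x
  proof (cases "\<sigma> \<gamma> = 1")
    case True
    then show ?thesis
      using f \<gamma> \<Gamma>\<^sub>p_iff by (simp add: invariant_polynomials_def)
  next
    case False
    define \<eta> where "\<eta> = \<gamma> \<otimes>\<^bsub>\<Gamma>\<^esub> inv\<^bsub>\<Gamma>\<^esub> \<delta>"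
    have \<eta>: "\<eta> \<in> carrier \<Gamma>" "\<gamma> = \<eta> \<otimes>\<^bsub>\<Gamma>\<^esub> \<delta>"
      using \<gamma> \<delta>(1) by (simp_all add: \<eta>_def m_assoc)
    have "\<sigma> \<eta> = 1"
      using \<sigma>_mult[OF \<eta>(1) \<delta>(1)] \<eta>(2) \<delta>(2) \<sigma>_values[OF \<gamma>] False by simp
    then have "f (\<rho> \<eta> (\<rho> \<delta> x)) = f (\<rho> \<delta> x)"
      using f \<eta>(1) \<Gamma>\<^sub>p_iff by (simp add: invariant_polynomials_def)
    then show ?thesis
      using \<rho>_mult[OF \<eta>(1) \<delta>(1)] \<eta>(2) False by simp
  qed
  \<comment> \<open>\<open>R0 f\<close> is invariant under all of \<Gamma>, while
    \<open>R1 f\<close> transforms by the character \<sigma>.\<close>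
  have reynolds_action:
    "reynolds0 \<rho> \<delta> f (\<rho> \<gamma> x) = reynolds0 \<rho> \<delta> f x"
    "reynolds1 \<rho> \<delta> f (\<rho> \<gamma> x) = of_int (\<sigma> \<gamma>) * reynolds1 \<rho> \<delta> f x"
    if f: "f \<in> invariant_polynomials \<rho> \<Gamma>\<^sub>p" and \<gamma>: "\<gamma> \<in> carrier \<Gamma>" for f \<gamma> x
  proof -
    \<comment> \<open>The coset formula for \<delta>\<gamma>, whose sign is opposite to that of
      \<gamma>.\<close>
    have "f (\<rho> \<delta> (\<rho> \<gamma> x)) = (if \<sigma> \<gamma> = 1 then f (\<rho> \<delta> x) else f x)"
      using coset[OF f, of "\<delta> \<otimes>\<^bsub>\<Gamma>\<^esub> \<gamma>" x] \<rho>_mult[OF \<delta>(1) \<gamma>] \<sigma>_mult[OF \<delta>(1) \<gamma>] \<delta> \<gamma> \<sigma>_values[OF \<gamma>]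
      by auto
    then show "reynolds0 \<rho> \<delta> f (\<rho> \<gamma> x) = reynolds0 \<rho> \<delta> f x"
      "reynolds1 \<rho> \<delta> f (\<rho> \<gamma> x) = of_int (\<sigma> \<gamma>) * reynolds1 \<rho> \<delta> f x"
      using coset[OF f \<gamma>, of x] \<sigma>_values[OF \<gamma>]
      by (auto simp: reynolds0_def reynolds1_def field_simps)
  qed
  have reynolds_polynomial:
    "real_polynomial_function (reynolds0 \<rho> \<delta> f)" "real_polynomial_function (reynolds1 \<rho> \<delta> f)"
    if "f \<in> invariant_polynomials \<rho> \<Gamma>\<^sub>p" for f
  proof -
    have "real_polynomial_function f"
      using that by (simp add: invariant_polynomials_def)
    moreover from this have "real_polynomial_function (\<lambda>x. f (\<rho> \<delta> x))"
      using bounded_linear_action[OF \<delta>(1)] by (rule real_polynomial_function_compose_bounded_linear)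
    ultimately show "real_polynomial_function (reynolds0 \<rho> \<delta> f)"
      "real_polynomial_function (reynolds1 \<rho> \<delta> f)"
      unfolding reynolds0_def reynolds1_def
      by (auto intro: real_polynomial_function_divide)
  qed
  have "reynolds0 \<rho> \<delta> f \<in> invariant_polynomials \<rho> (carrier \<Gamma>)"
    if "f \<in> invariant_polynomials \<rho> \<Gamma>\<^sub>p" for f
    using reynolds_polynomial[OF that] reynolds_action[OF that]
    by (simp add: invariant_polynomials_def)
  moreover have "(\<lambda>x. reynolds1 \<rho> \<delta> f x * reynolds1 \<rho> \<delta> g x) \<in> invariant_polynomials \<rho> (carrier \<Gamma>)"
    if f: "f \<in> invariant_polynomials \<rho> \<Gamma>\<^sub>p" and g: "g \<in> invariant_polynomials \<rho> \<Gamma>\<^sub>p" for f g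
  proof -
    \<comment> \<open>Both factors change by the same sign \<open>\<sigma> \<gamma>\<close>, and its
      square is 1.\<close>
    have "reynolds1 \<rho> \<delta> f (\<rho> \<gamma> x) * reynolds1 \<rho> \<delta> g (\<rho> \<gamma> x) = reynolds1 \<rho> \<delta> f x * reynolds1 \<rho> \<delta> g x"
      if "\<gamma> \<in> carrier \<Gamma>" for \<gamma> x
      using \<sigma>_values[OF that] by (auto simp: reynolds_action f g that)
    then show ?thesis
      using reynolds_polynomial[OF f] reynolds_polynomial[OF g]
      by (auto simp: invariant_polynomials_def)
  qed
  ultimately have "?W \<subseteq> invariant_polynomials \<rho> (carrier \<Gamma>)"
    using basis(2) by blast
  moreover have "finite ?W"
    unfolding finite_Un
  proof
    show "finite {reynolds0 \<rho> \<delta> (u i) | i. i \<in> {1..s}}"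
      by (rule finite_image_set) simp
    show "finite {(\<lambda>x. reynolds1 \<rho> \<delta> (u i) x * reynolds1 \<rho> \<delta> (u j) x) | i j. i \<in> {1..s} \<and> j \<in> {1..s}}"
      by (rule finite_image_set2) simp_all
  qed
  moreover have "f \<in> generated_algebra ?W" if f: "f \<in> invariant_polynomials \<rho> (carrier \<Gamma>)" for f
  proof -
    \<comment> \<open>Invariance under \<Gamma> includes invariance under the subset
      \<open>\<Gamma>\<^sub>p\<close>, so the given Hilbert basis applies to
      \<open>f\<close>.\<close>
    have "f \<in> generated_algebra ?U"
      using f basis(3) \<Gamma>\<^sub>p_iff by (auto simp: invariant_polynomials_def)
    then have "reynolds0 \<rho> \<delta> f \<in> generated_algebra ?W"
      by (rule reynolds_generated_algebra[THEN conjunct1]) blast+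
    moreover have "reynolds0 \<rho> \<delta> f = f"
      using f \<delta>(1) by (simp add: reynolds0_def invariant_polynomials_def)
    ultimately show ?thesis
      by simp
  qed
  ultimately show ?thesis
    unfolding hilbert_basis_iff_generated_algebra by blast
qed

end
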